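(* Let $\mathbb{F}$ be a finite field with $|\mathbb{F}|=q$. For each positive integer $n$, let $\rho_n\colon 2^{\mathbb{F}^n}\to[0,1]$, $\rho_n(X)=\dim(\operatorname{span}(X))/n$ for $X\subseteq\mathbb{F}^n$, be the normalized rank function of the linear space $\mathbb{F}^n$. Then the sequence $(\rho_n\colon n\ge 1)$ is quotient-convergent.
   Context: For a positive integer $k$, write $[k]=\{1,\dots,k\}$. Let $J$ be a finite set and $\varphi\colon 2^J\to\mathbb{R}$ a setfunction with $\varphi(\emptyset)=0$. For $\mathbf{A}=(A_1,\dots,A_k)$ with $A_i\subseteq J$, define $\varphi/\mathbf{A}\colon 2^{[k]}\to\mathbb{R}$ by $(\varphi/\mathbf{A})(I)=\varphi\big(\bigcup_{i\in I}A_i\big)$. The $k$-quotient set of $\varphi$ is $Q_k(\varphi)=\{\varphi/\mathbf{A}\colon \mathbf{A}=(A_1,\dots,A_k)\text{ is a partition of }J\}$, where classes of the partition may be empty (equivalently, $Q_k(\varphi)$ is the set of all $\varphi\circ F^{-1}$ with $F\colon J\to[k]$). It is regarded as a subset of $\mathbb{R}^{2^k}$ with the $\ell^\infty$ norm. A sequence $(\varphi_n)$ of such setfunctions (on possibly different finite sets) is quotient-convergent if for every positive integer $k$ the sequence $(Q_k(\varphi_n))$ is a Cauchy sequence with respect to the Hausdorff distance. *)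

theory Defs
  imports Complex_Main "HOL-Library.Disjoint_Sets" "HOL-Library.FuncSet"
    "HOL-Library.Function_Algebras"
begin

section \<open>Quotient convergence of setfunctions\<close>

text \<open>A setfunction on \<open>J\<close> is represented by a function on all sets over the ambient type;
  only its values on subsets of \<open>J\<close> are relevant.\<close>

definition setfunction :: "'a set \<Rightarrow> ('a set \<Rightarrow> real) \<Rightarrow> bool" where
  "setfunction J \<phi> \<longleftrightarrow> finite J \<and> \<phi> {} = 0"

text \<open>Partitions into \<open>k\<close> labelled classes, empty classes being allowed (unlike in \<open>partition_on\<close>).\<close>

definition labelled_partition :: "nat \<Rightarrow> 'a set \<Rightarrow> (nat \<Rightarrow> 'a set) \<Rightarrow> bool" where
  "labelled_partition k J A \<longleftrightarrow> disjoint_family_on A {1..k} \<and> (\<Union>i\<in>{1..k}. A i) = J"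

text \<open>The restriction to \<open>Pow {1..k}\<close> makes the quotient a point of \<open>\<real>\<close> to the power \<open>2 ^ k\<close>:
  two quotients are equal iff they agree on all subsets of \<open>{1..k}\<close>.\<close>

definition quotient_fun :: "nat \<Rightarrow> ('a set \<Rightarrow> real) \<Rightarrow> (nat \<Rightarrow> 'a set) \<Rightarrow> nat set \<Rightarrow> real" where
  "quotient_fun k \<phi> A = (\<lambda>I\<in>Pow {1..k}. \<phi> (\<Union>i\<in>I. A i))"

definition quotient_set :: "nat \<Rightarrow> 'a set \<Rightarrow> ('a set \<Rightarrow> real) \<Rightarrow> (nat set \<Rightarrow> real) set" where
  "quotient_set k J \<phi> = {quotient_fun k \<phi> A | A. labelled_partition k J A}"

definition linf_dist :: "nat \<Rightarrow> (nat set \<Rightarrow> real) \<Rightarrow> (nat set \<Rightarrow> real) \<Rightarrow> real" where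
  "linf_dist k f g = Max ((\<lambda>I. \<bar>f I - g I\<bar>) ` Pow {1..k})"

text \<open>Meaningful for nonempty bounded sets, since suprema and infima are taken in \<open>real\<close>;
  the quotient sets of a setfunction are finite, and nonempty for \<open>k \<ge> 1\<close>.\<close>

definition hausdorff_dist :: "('b \<Rightarrow> 'b \<Rightarrow> real) \<Rightarrow> 'b set \<Rightarrow> 'b set \<Rightarrow> real" where
  "hausdorff_dist d X Y = max (SUP x\<in>X. INF y\<in>Y. d x y) (SUP y\<in>Y. INF x\<in>X. d x y)"

definition quotient_convergent ::
    "(nat \<Rightarrow> 'a set) \<Rightarrow> (nat \<Rightarrow> 'a set \<Rightarrow> real) \<Rightarrow> bool" where
  "quotient_convergent J \<phi> \<longleftrightarrow>
     (\<forall>n. setfunction (J n) (\<phi> n)) \<and>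
     (\<forall>k\<ge>1. \<forall>\<epsilon>>0. \<exists>N. \<forall>m\<ge>N. \<forall>n\<ge>N.
        hausdorff_dist (linf_dist k) (quotient_set k (J m) (\<phi> m)) (quotient_set k (J n) (\<phi> n)) < \<epsilon>)"


section \<open>The spaces \<open>F\<^sup>n\<close> and their normalized rank functions\<close>

text \<open>Since \<open>n\<close> varies, \<open>F\<^sup>n\<close> is realized inside the space of all sequences over \<open>F\<close>, as the
  subspace of those vanishing from index \<open>n\<close> on. Addition is the pointwise addition of
  \<open>HOL-Library.Function_Algebras\<close>.\<close>

definition fscale :: "'f::field \<Rightarrow> (nat \<Rightarrow> 'f) \<Rightarrow> nat \<Rightarrow> 'f" where
  "fscale c v = (\<lambda>i. c * v i)"

global_interpretation fvec: vector_space "fscale :: 'f::field \<Rightarrow> (nat \<Rightarrow> 'f) \<Rightarrow> nat \<Rightarrow> 'f"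
  by standard (simp_all add: fscale_def fun_eq_iff algebra_simps)

definition coord_space :: "nat \<Rightarrow> (nat \<Rightarrow> 'f::field) set" where
  "coord_space n = {v. \<forall>i\<ge>n. v i = 0}"

definition normalized_rank :: "nat \<Rightarrow> (nat \<Rightarrow> 'f::field) set \<Rightarrow> real" where
  "normalized_rank n X = real (fvec.dim (fvec.span X)) / real n"

lemma subspace_coord_space: "fvec.subspace (coord_space n)"
  by (auto simp: fvec.subspace_def coord_space_def fscale_def)

lemma dim_coord_space: "fvec.dim (coord_space n :: (nat \<Rightarrow> 'f::field) set) = n"
proof -
  define e :: "nat \<Rightarrow> nat \<Rightarrow> 'f" where "e i = (\<lambda>j. if j = i then 1 else 0)" for i
  have inj: "inj e"
    by (rule injI) (metis e_def zero_neq_one)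
  have sum_apply: "(\<Sum>v\<in>e ` {..<m}. fscale (c v) v) j = (if j < m then c (e j) else 0)" for c m j
  proof -
    have "(\<Sum>v\<in>e ` {..<m}. fscale (c v) v) j = (\<Sum>i<m. fscale (c (e i)) (e i)) j"
      by (subst sum.reindex[OF inj_on_subset[OF inj subset_UNIV]]) simp
    also have "\<dots> = (if j < m then c (e j) else 0)"
      by (induction m) (auto simp: fscale_def e_def less_Suc_eq)
    finally show ?thesis .
  qed
  have "fvec.independent (e ` {..<n})"
  proof (rule fvec.independent_if_scalars_zero)
    fix c w assume *: "(\<Sum>v\<in>e ` {..<n}. fscale (c v) v) = 0" and "w \<in> e ` {..<n}"
    then obtain j where "w = e j" "j < n"
      by blast
    then show "c w = 0"
      using sum_apply[of c n j] * by simp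
  qed simp
  moreover have "e ` {..<n} \<subseteq> coord_space n"
    by (auto simp: e_def coord_space_def)
  moreover have "coord_space n \<subseteq> fvec.span (e ` {..<n})"
  proof
    fix v :: "nat \<Rightarrow> 'f" assume "v \<in> coord_space n"
    then have "v = (\<Sum>w\<in>e ` {..<n}. fscale (v (inv e w)) w)"
      using inj by (intro ext) (simp add: sum_apply coord_space_def)
    also have "\<dots> \<in> fvec.span (e ` {..<n})"
      by (intro fvec.span_sum fvec.span_scale fvec.span_base)
    finally show "v \<in> fvec.span (e ` {..<n})" .
  qed
  moreover have "card (e ` {..<n}) = n"
    using card_image[OF inj_on_subset[OF inj subset_UNIV]] by simp
  ultimately show ?thesis
    by (intro fvec.dim_unique)
qed

lemma finite_coord_space: "finite (coord_space n :: (nat \<Rightarrow> 'f::{field,finite}) set)"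
proof (rule finite_subset)
  show "coord_space n \<subseteq> (\<lambda>v i. if i < n then v i else 0) ` ({..<n} \<rightarrow>\<^sub>E (UNIV :: 'f set))"
  proof
    fix v :: "nat \<Rightarrow> 'f" assume "v \<in> coord_space n"
    then have "v = (\<lambda>i. if i < n then restrict v {..<n} i else 0)"
      by (auto simp: coord_space_def fun_eq_iff)
    moreover have "restrict v {..<n} \<in> {..<n} \<rightarrow>\<^sub>E UNIV"
      by simp
    ultimately show "v \<in> (\<lambda>v i. if i < n then v i else 0) ` ({..<n} \<rightarrow>\<^sub>E UNIV)"
      by (rule image_eqI)
  qed
qed (auto intro!: finite_imageI finite_PiE)

lemma normalized_rank_range:
  assumes "X \<subseteq> (coord_space n :: (nat \<Rightarrow> 'f::{field,finite}) set)"
  shows "normalized_rank n X \<in> {0..1}"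
proof -
  obtain B :: "(nat \<Rightarrow> 'f) set" where B: "B \<subseteq> coord_space n" "coord_space n \<subseteq> fvec.span B"
    "card B = fvec.dim (coord_space n :: (nat \<Rightarrow> 'f) set)"
    using fvec.basis_exists by metis
  have "fvec.dim X \<le> card B"
    using assms B finite_subset[OF B(1) finite_coord_space] by (intro fvec.dim_le_card) auto
  then show ?thesis
    by (simp add: normalized_rank_def B(3) dim_coord_space divide_le_eq)
qed

end

theory Submission
  imports Defs
begin

text \<open>
  Write \<open>Q\<^sub>n\<close> for the set of \<open>k\<close>-quotients of the normalized rank function of \<open>F\<^sup>n\<close>.
  The proof rests on two ideas.

  First, it suffices to approximate points of \<open>Q\<^sub>n\<close> by points of \<open>Q\<^sub>m\<close> when \<open>n\<close> is large
  and \<open>m\<close> is huge compared with \<open>n\<close>. The reason is compactness: all \<open>Q\<^sub>n\<close> lie in the same cube \<open>[0,1]\<close> to the power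
  \<open>2 ^ k\<close>, so the union of those with large \<open>n\<close> is represented up to \<open>\<epsilon>\<close> by finitely many of its points, each
  of which is close to \<open>Q\<^sub>m\<close> for all large \<open>m\<close>. The resulting approximation is uniform in \<open>n\<close> and
  therefore bounds the Hausdorff distance from both sides (\<open>uniform_approximation\<close>,
  \<open>quotient_convergentI\<close>). No quotient of a large space has to be transported to a smaller space
  explicitly.

  Second, such an approximation is obtained by copying. In a partition of \<open>F\<^sup>n\<close> into \<open>k\<close> classes,
  one class \<open>A\<^sub>s\<close> has rank at least \<open>n - k\<close>, because \<open>k\<close> subspaces of larger codimension have too few
  elements to cover \<open>F\<^sup>n\<close> (\<open>labelled_partition_large_class\<close>). Split the coordinates of \<open>F\<^sup>m\<close>
  into \<open>d = m div n\<close> blocks of length \<open>n\<close> and a shorter remainder. Every class other than \<open>A\<^sub>s\<close> is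
  replaced by the copies of its nonzero vectors in the \<open>d\<close> blocks, and class \<open>s\<close> receives all remaining
  vectors. Unions of classes without \<open>s\<close> have their rank multiplied by exactly \<open>d\<close>, and \<open>d / m\<close>
  is close to \<open>1 / n\<close>. Unions of classes with \<open>s\<close> had normalized rank at least \<open>1 - k / n\<close>, and now have
  normalized rank 1, because as soon as there are three blocks the vectors that are not supported in a
  single block span \<open>F\<^sup>m\<close> (\<open>span_outside_block_copies\<close>). So the error is at most the
  maximum of \<open>k / n\<close> and \<open>n / m\<close> (\<open>quotient_approximation\<close>).
\<close>

section \<open>One-sided approximation suffices\<close>

lemma linf_dist_le_iff:
  "linf_dist k f g \<le> e \<longleftrightarrow> (\<forall>I\<subseteq>{1..k}. \<bar>f I - g I\<bar> \<le> e)"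
  unfolding linf_dist_def by (subst Max_le_iff) auto

lemma linf_dist_nonneg: "0 \<le> linf_dist k f g"
proof -
  have "\<bar>f {} - g {}\<bar> \<le> linf_dist k f g"
    using linf_dist_le_iff[of k f g "linf_dist k f g"] by blast
  then show ?thesis by linarith
qed

lemma linf_dist_triangle: "linf_dist k f h \<le> linf_dist k f g + linf_dist k g h"
proof -
  have "\<bar>f I - h I\<bar> \<le> linf_dist k f g + linf_dist k g h" if "I \<subseteq> {1..k}" for I
  proof -
    have "\<bar>f I - g I\<bar> \<le> linf_dist k f g" "\<bar>g I - h I\<bar> \<le> linf_dist k g h"
      using that linf_dist_le_iff by blast+
    then show ?thesis by linarith
  qed
  then show ?thesis by (simp add: linf_dist_le_iff)
qed

lemma hausdorff_dist_leI:
  assumes "X \<noteq> {}" "Y \<noteq> {}" "\<And>x y. 0 \<le> d x y"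
    and "\<And>x. x \<in> X \<Longrightarrow> \<exists>y\<in>Y. d x y \<le> e" "\<And>y. y \<in> Y \<Longrightarrow> \<exists>x\<in>X. d x y \<le> e"
  shows "hausdorff_dist d X Y \<le> e"
proof -
  have bdd: "bdd_below ((\<lambda>y. d x y) ` Y)" "bdd_below ((\<lambda>x. d x y) ` X)" for x y
    using assms(3) by (auto intro!: bdd_belowI[of _ 0])
  have "(SUP x\<in>X. INF y\<in>Y. d x y) \<le> e"
    using assms(1,4) bdd(1) by (intro cSUP_least) (auto intro: cINF_lower2)
  moreover have "(SUP y\<in>Y. INF x\<in>X. d x y) \<le> e"
    using assms(2,5) bdd(2) by (intro cSUP_least) (auto intro: cINF_lower2)
  ultimately show ?thesis
    by (simp add: hausdorff_dist_def)
qed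

text \<open>The cube \<open>[0,1]\<^bsup>Pow {1..k}\<^esup>\<close> is totally bounded: rounding every coordinate down to a
  multiple of \<open>1/K\<close> leaves finitely many cells of diameter at most \<open>1/K\<close>.\<close>

lemma finite_cells_cube:
  assumes "\<epsilon> > 0"
  obtains cell :: "(nat set \<Rightarrow> real) \<Rightarrow> nat set \<Rightarrow> int" and C
  where "finite C"
    and "\<And>f. (\<And>I. I \<subseteq> {1..k} \<Longrightarrow> f I \<in> {0..1}) \<Longrightarrow> cell f \<in> C"
    and "\<And>f g. cell f = cell g \<Longrightarrow> linf_dist k f g \<le> \<epsilon>"
proof -
  obtain K :: nat where K: "K > 0" "1 / real K < \<epsilon>"
    using assms by (metis nat_approx_posE zero_less_Suc)
  define cell :: "(nat set \<Rightarrow> real) \<Rightarrow> nat set \<Rightarrow> int"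
    where "cell f = (\<lambda>I\<in>Pow {1..k}. \<lfloor>f I * real K\<rfloor>)" for f
  define C :: "(nat set \<Rightarrow> int) set" where "C = Pow {1..k} \<rightarrow>\<^sub>E {0..int K}"
  show ?thesis
  proof (rule that[of C cell])
    show "finite C"
      by (simp add: C_def finite_PiE)
  next
    fix f :: "nat set \<Rightarrow> real" assume f: "\<And>I. I \<subseteq> {1..k} \<Longrightarrow> f I \<in> {0..1}"
    have "\<lfloor>f I * real K\<rfloor> \<in> {0..int K}" if "I \<subseteq> {1..k}" for I
    proof -
      have "f I * real K \<le> 1 * real K"
        using f[OF that] by (intro mult_right_mono) auto
      then have "\<lfloor>f I * real K\<rfloor> \<le> int K"
        by linarith
      then show ?thesis
        using f[OF that] by simp
    qed
    then show "cell f \<in> C"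
      by (auto simp: cell_def C_def)
  next
    fix f g :: "nat set \<Rightarrow> real" assume eq: "cell f = cell g"
    have "\<bar>f I - g I\<bar> \<le> \<epsilon>" if "I \<subseteq> {1..k}" for I
    proof -
      have "\<lfloor>f I * real K\<rfloor> = \<lfloor>g I * real K\<rfloor>"
        using fun_cong[OF eq, of I] that by (simp add: cell_def)
      then have "\<bar>f I * real K - g I * real K\<bar> \<le> 1"
        by linarith
      then have "\<bar>f I - g I\<bar> * real K \<le> 1"
        by (simp add: abs_mult flip: left_diff_distrib)
      then have "\<bar>f I - g I\<bar> \<le> 1 / real K"
        using K(1) by (simp add: field_simps)
      then show ?thesis
        using K(2) by linarith
    qed
    then show "linf_dist k f g \<le> \<epsilon>"
      by (simp add: linf_dist_le_iff)
  qed
qed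

text \<open>In the hypothesis the bound on \<open>m\<close> may depend on \<open>n\<close>; the conclusion is uniform in \<open>n\<close>.
  Pick one representative point in each of the finitely many cells that some \<open>Q n\<close> meets: from
  some \<open>M\<close> on, every \<open>Q m\<close> comes close to all the representatives, hence to every point of
  every \<open>Q n\<close>.\<close>

lemma uniform_approximation:
  fixes Q :: "nat \<Rightarrow> (nat set \<Rightarrow> real) set"
  assumes range: "\<And>n f I. f \<in> Q n \<Longrightarrow> I \<subseteq> {1..k} \<Longrightarrow> f I \<in> {0..1}"
    and approx: "\<And>n. n \<ge> N \<Longrightarrow> \<exists>M. \<forall>m\<ge>M. \<forall>f\<in>Q n. \<exists>g\<in>Q m. linf_dist k f g \<le> \<epsilon>"
    and "\<epsilon> > 0"
  shows "\<exists>M. \<forall>n\<ge>N. \<forall>m\<ge>M. \<forall>f\<in>Q n. \<exists>g\<in>Q m. linf_dist k f g \<le> 2 * \<epsilon>"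
proof -
  obtain cell :: "(nat set \<Rightarrow> real) \<Rightarrow> nat set \<Rightarrow> int" and C where C: "finite C"
    and cell_in: "\<And>f. (\<And>I. I \<subseteq> {1..k} \<Longrightarrow> f I \<in> {0..1}) \<Longrightarrow> cell f \<in> C"
    and close: "\<And>f g. cell f = cell g \<Longrightarrow> linf_dist k f g \<le> \<epsilon>"
    using finite_cells_cube[OF \<open>\<epsilon> > 0\<close>, of k] by metis
  have "\<exists>M. \<forall>n\<ge>N. \<forall>m\<ge>M. \<forall>f\<in>Q n. cell f = c \<longrightarrow> (\<exists>g\<in>Q m. linf_dist k f g \<le> 2 * \<epsilon>)" for c
  proof (cases "\<exists>n\<ge>N. \<exists>f\<in>Q n. cell f = c")
    case True
    then obtain n0 f0 where f0: "n0 \<ge> N" "f0 \<in> Q n0" "cell f0 = c"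
      by blast
    then obtain M where M: "\<And>m. m \<ge> M \<Longrightarrow> \<exists>g\<in>Q m. linf_dist k f0 g \<le> \<epsilon>"
      using approx[of n0] by blast
    have "\<exists>g\<in>Q m. linf_dist k f g \<le> 2 * \<epsilon>" if m: "m \<ge> M" and f: "cell f = c" for m f
    proof -
      obtain g where g: "g \<in> Q m" "linf_dist k f0 g \<le> \<epsilon>"
        using M[OF m] by blast
      have "linf_dist k f f0 \<le> \<epsilon>"
        using close f0(3) f by simp
      then have "linf_dist k f g \<le> 2 * \<epsilon>"
        using g(2) linf_dist_triangle[of k f g f0] by linarith
      then show ?thesis
        using g(1) by blast
    qed
    then show ?thesis by blast
  qed blast
  then obtain M where M: "\<And>c n m f. n \<ge> N \<Longrightarrow> m \<ge> M c \<Longrightarrow> f \<in> Q n \<Longrightarrow> cell f = c \<Longrightarrow>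
      \<exists>g\<in>Q m. linf_dist k f g \<le> 2 * \<epsilon>"
    by metis
  \<comment> \<open>The sum serves as a common upper bound of the thresholds of all cells.\<close>
  have "\<exists>g\<in>Q m. linf_dist k f g \<le> 2 * \<epsilon>"
    if "n \<ge> N" "m \<ge> (\<Sum>c\<in>C. M c)" "f \<in> Q n" for n m f
  proof (rule M[OF that(1) _ that(3) refl])
    have "cell f \<in> C"
      using range[OF that(3)] by (rule cell_in)
    then have "M (cell f) \<le> (\<Sum>c\<in>C. M c)"
      using C by (intro member_le_sum) auto
    then show "M (cell f) \<le> m"
      using that(2) by linarith
  qed
  then show ?thesis by blast
qed

lemma quotient_set_nonempty:
  assumes "k \<ge> 1"
  shows "quotient_set k J \<phi> \<noteq> {}"
proof -
  have "labelled_partition k J (\<lambda>i. if i = 1 then J else {})"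
    using assms by (auto simp: labelled_partition_def disjoint_family_on_def)
  then show ?thesis
    unfolding quotient_set_def by blast
qed

lemma quotient_convergentI:
  assumes fin: "\<And>n. setfunction (J n) (\<phi> n)"
    and range: "\<And>n X. X \<subseteq> J n \<Longrightarrow> \<phi> n X \<in> {0..1}"
    and approx: "\<And>k \<epsilon>. k \<ge> 1 \<Longrightarrow> \<epsilon> > 0 \<Longrightarrow> \<exists>N. \<forall>n\<ge>N. \<exists>M. \<forall>m\<ge>M.
       \<forall>f\<in>quotient_set k (J n) (\<phi> n). \<exists>g\<in>quotient_set k (J m) (\<phi> m). linf_dist k f g \<le> \<epsilon>"
  shows "quotient_convergent J \<phi>"
  unfolding quotient_convergent_def
proof (intro conjI allI impI)
  fix n show "setfunction (J n) (\<phi> n)" by (rule fin)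
next
  fix k :: nat and \<epsilon> :: real assume "k \<ge> 1" "\<epsilon> > 0"
  define Q where "Q n = quotient_set k (J n) (\<phi> n)" for n
  have Q_range: "f I \<in> {0..1}" if f: "f \<in> Q n" and I: "I \<subseteq> {1..k}" for n f I
  proof -
    obtain A where A: "labelled_partition k (J n) A" "f = quotient_fun k (\<phi> n) A"
      using f unfolding Q_def quotient_set_def by blast
    have "(\<Union>i\<in>I. A i) \<subseteq> J n"
      using A(1) I unfolding labelled_partition_def by blast
    then show ?thesis
      using range A(2) I by (simp add: quotient_fun_def)
  qed
  obtain N where N: "\<And>n. n \<ge> N \<Longrightarrow> \<exists>M. \<forall>m\<ge>M. \<forall>f\<in>Q n. \<exists>g\<in>Q m. linf_dist k f g \<le> \<epsilon> / 3"
    using approx[OF \<open>k \<ge> 1\<close>, of "\<epsilon> / 3"] \<open>\<epsilon> > 0\<close> unfolding Q_def by auto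
  have "\<exists>M. \<forall>n\<ge>N. \<forall>m\<ge>M. \<forall>f\<in>Q n. \<exists>g\<in>Q m. linf_dist k f g \<le> 2 * (\<epsilon> / 3)"
  proof (rule uniform_approximation)
    show "\<epsilon> / 3 > 0" using \<open>\<epsilon> > 0\<close> by simp
  qed (fact Q_range N)+
  then obtain M where M: "\<forall>n\<ge>N. \<forall>m\<ge>M. \<forall>f\<in>Q n. \<exists>g\<in>Q m. linf_dist k f g \<le> 2 * (\<epsilon> / 3)" ..
  have sym: "linf_dist k f g = linf_dist k g f" for f g
    by (simp add: linf_dist_def abs_minus_commute)
  have "hausdorff_dist (linf_dist k) (Q m) (Q n) < \<epsilon>" if "m \<ge> max N M" "n \<ge> max N M" for m n
  proof -
    have "hausdorff_dist (linf_dist k) (Q m) (Q n) \<le> 2 * (\<epsilon> / 3)"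
    proof (rule hausdorff_dist_leI)
      show "Q m \<noteq> {}" "Q n \<noteq> {}"
        using \<open>k \<ge> 1\<close> by (simp_all add: Q_def quotient_set_nonempty)
      show "\<exists>g\<in>Q n. linf_dist k f g \<le> 2 * (\<epsilon> / 3)" if "f \<in> Q m" for f
        using M[rule_format, of m n f] that \<open>m \<ge> max N M\<close> \<open>n \<ge> max N M\<close> by simp
      show "\<exists>f\<in>Q m. linf_dist k f g \<le> 2 * (\<epsilon> / 3)" if "g \<in> Q n" for g
        using M[rule_format, of n m g] that \<open>m \<ge> max N M\<close> \<open>n \<ge> max N M\<close> by (simp add: sym)
    qed (rule linf_dist_nonneg)
    then show ?thesis
      using \<open>\<epsilon> > 0\<close> by linarith
  qed
  then show "\<exists>N. \<forall>m\<ge>N. \<forall>n\<ge>N.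
      hausdorff_dist (linf_dist k) (quotient_set k (J m) (\<phi> m)) (quotient_set k (J n) (\<phi> n)) < \<epsilon>"
    unfolding Q_def by blast
qed

section \<open>A class of almost full rank\<close>

lemma card_field_ge_2: "2 \<le> card (UNIV :: 'f::{field,finite} set)"
  using card_mono[of UNIV "{0, 1 :: 'f}"] by simp

lemma dim_mono_finite:
  assumes "X \<subseteq> Y" "finite (Y :: (nat \<Rightarrow> 'f::field) set)"
  shows "fvec.dim X \<le> fvec.dim Y"
proof -
  obtain B where B: "B \<subseteq> Y" "Y \<subseteq> fvec.span B" "card B = fvec.dim Y"
    using fvec.basis_exists by metis
  have "finite B"
    using B(1) assms(2) by (rule finite_subset)
  moreover have "X \<subseteq> fvec.span B"
    using assms(1) B(2) by blast
  ultimately show ?thesis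
    using fvec.dim_le_card B(3) by metis
qed

lemma card_le_power_dim:
  assumes "finite (X :: (nat \<Rightarrow> 'f::{field,finite}) set)"
  shows "card X \<le> card (UNIV :: 'f set) ^ fvec.dim X"
proof -
  obtain B where B: "B \<subseteq> X" "X \<subseteq> fvec.span B" "card B = fvec.dim X"
    using fvec.basis_exists by metis
  have fB: "finite B"
    using B(1) assms by (rule finite_subset)
  let ?comb = "\<lambda>u. \<Sum>v\<in>B. fscale (u v) v"
  have "fvec.span B \<subseteq> ?comb ` (B \<rightarrow>\<^sub>E UNIV)"
  proof
    fix x assume "x \<in> fvec.span B"
    then obtain u where "x = ?comb u"
      using fvec.span_finite[OF fB] by blast
    then have "x = ?comb (restrict u B)"
      by (simp cong: sum.cong)
    then show "x \<in> ?comb ` (B \<rightarrow>\<^sub>E UNIV)"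
      by (intro image_eqI[where x = "restrict u B"]) simp_all
  qed
  then have "card X \<le> card (?comb ` (B \<rightarrow>\<^sub>E UNIV))"
    using B(2) fB by (intro card_mono) (auto intro!: finite_imageI finite_PiE)
  also have "\<dots> \<le> card (B \<rightarrow>\<^sub>E (UNIV :: 'f set))"
    using fB by (intro card_image_le finite_PiE) auto
  also have "\<dots> = card (UNIV :: 'f set) ^ card B"
    using fB by (simp add: card_PiE)
  finally show ?thesis
    by (simp add: B(3))
qed

lemma power_le_card_coord_space:
  "card (UNIV :: 'f set) ^ n \<le> card (coord_space n :: (nat \<Rightarrow> 'f::{field,finite}) set)"
proof -
  let ?ext = "\<lambda>v i. if i < n then v i else (0::'f)"
  have "inj_on ?ext ({..<n} \<rightarrow>\<^sub>E UNIV)"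
  proof (rule inj_onI)
    fix u v assume uv: "u \<in> {..<n} \<rightarrow>\<^sub>E UNIV" "v \<in> {..<n} \<rightarrow>\<^sub>E UNIV" and eq: "?ext u = ?ext v"
    show "u = v"
    proof (rule PiE_ext[OF uv])
      fix i assume "i \<in> {..<n}"
      then show "u i = v i" using fun_cong[OF eq, of i] by simp
    qed
  qed
  moreover have "?ext ` ({..<n} \<rightarrow>\<^sub>E UNIV) \<subseteq> coord_space n"
    unfolding coord_space_def by (rule image_subsetI) simp
  ultimately have "card ({..<n} \<rightarrow>\<^sub>E (UNIV :: 'f set)) \<le> card (coord_space n :: (nat \<Rightarrow> 'f) set)"
    using finite_coord_space by (rule card_inj_on_le)
  then show ?thesis
    by (simp add: card_PiE)
qed

text \<open>The reason is counting, with \<open>q\<close> the size of the field: if all \<open>k\<close> classes had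
  codimension more than \<open>k\<close>, they would together have at most \<open>k * q ^ (n - k) < q ^ n\<close> elements,
  as \<open>k < 2 ^ k \<le> q ^ k\<close>.\<close>

lemma labelled_partition_large_class:
  fixes A :: "nat \<Rightarrow> (nat \<Rightarrow> 'f::{field,finite}) set"
  assumes "labelled_partition k (coord_space n) A"
  obtains s where "s \<in> {1..k}" "n \<le> fvec.dim (A s) + k"
proof (rule ccontr)
  assume none: "\<not> thesis"
  note large = that
  have small: "fvec.dim (A i) + k < n" if "i \<in> {1..k}" for i
    using none large[OF that] by (meson not_le)
  let ?q = "card (UNIV :: 'f set)"
  have q: "2 \<le> ?q" by (rule card_field_ge_2)
  have cover: "(\<Union>i\<in>{1..k}. A i) = coord_space n"
    using assms by (simp add: labelled_partition_def)
  have "?q ^ n \<le> card (\<Union>i\<in>{1..k}. A i)"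
    unfolding cover by (rule power_le_card_coord_space)
  also have "\<dots> \<le> (\<Sum>i\<in>{1..k}. card (A i))"
    by (rule card_UN_le) simp
  also have "\<dots> \<le> (\<Sum>i\<in>{1..k}. ?q ^ (n - k))"
  proof (rule sum_mono)
    fix i assume i: "i \<in> {1..k}"
    have "finite (A i)"
      using i cover finite_subset[OF _ finite_coord_space, of "A i" n] by blast
    then have "card (A i) \<le> ?q ^ fvec.dim (A i)"
      by (rule card_le_power_dim)
    also have "\<dots> \<le> ?q ^ (n - k)"
      using small[OF i] q by (intro power_increasing) auto
    finally show "card (A i) \<le> ?q ^ (n - k)" .
  qed
  also have "\<dots> = k * ?q ^ (n - k)"
    by simp
  finally have le: "?q ^ n \<le> k * ?q ^ (n - k)" .
  have "k \<noteq> 0"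
    using le q by (cases k) auto
  then have "k \<le> n"
    using small[of 1] by simp
  have "k < ?q ^ k"
    using less_exp[of k] power_mono[OF q, of k] by linarith
  then have "k * ?q ^ (n - k) < ?q ^ k * ?q ^ (n - k)"
    using q by simp
  also have "\<dots> = ?q ^ n"
    using \<open>k \<le> n\<close> by (simp flip: power_add)
  finally show False
    using le by simp
qed

section \<open>Copying a configuration into blocks of coordinates\<close>

definition block_embed :: "nat \<Rightarrow> nat \<Rightarrow> (nat \<Rightarrow> 'f::field) \<Rightarrow> nat \<Rightarrow> 'f" where
  "block_embed n j v = (\<lambda>i. if i div n = j then v (i mod n) else 0)"

definition block_copies :: "nat \<Rightarrow> nat \<Rightarrow> (nat \<Rightarrow> 'f::field) set \<Rightarrow> (nat \<Rightarrow> 'f) set" where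
  "block_copies n d X = (\<Union>j<d. block_embed n j ` X)"

text \<open>This is the linearity of \<^term>\<open>block_embed n j\<close>.\<close>

lemma block_embed_in_span:
  assumes "x \<in> fvec.span B"
  shows "block_embed n j x \<in> fvec.span (block_embed n j ` B)"
  using assms
proof (induction rule: fvec.span_induct_alt)
  case base
  have "block_embed n j 0 = (0 :: nat \<Rightarrow> 'a)"
    by (simp add: block_embed_def fun_eq_iff)
  then show ?case
    using fvec.span_zero by metis
next
  case (step c x y)
  have "block_embed n j (fscale c x + y) = fscale c (block_embed n j x) + block_embed n j y"
    by (simp add: block_embed_def fscale_def fun_eq_iff)
  then show ?case
    using step by (metis fvec.span_add fvec.span_scale fvec.span_base imageI)
qed

lemma block_embed_apply:
  assumes "i < n"
  shows "block_embed n j v (j' * n + i) = (if j = j' then v i else 0)"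
  using assms by (auto simp: block_embed_def)

lemma block_embed_inject:
  assumes "v \<in> coord_space n" "w \<in> coord_space n" "v \<noteq> 0"
    and eq: "block_embed n j v = block_embed n l w"
  shows "j = l" "v = w"
proof -
  obtain i where i: "v i \<noteq> 0"
    using assms(3) by (auto simp: fun_eq_iff)
  have "i < n"
    by (rule ccontr) (use assms(1) i in \<open>simp add: coord_space_def\<close>)
  show "j = l"
    using fun_cong[OF eq, of "j * n + i"] i \<open>i < n\<close> by (auto simp: block_embed_apply split: if_splits)
  show "v = w"
  proof
    fix i show "v i = w i"
    proof (cases "i < n")
      case True
      then show ?thesis
        using fun_cong[OF eq, of "j * n + i"] \<open>j = l\<close> by (simp add: block_embed_apply)
    next
      case False
      then show ?thesis
        using assms(1,2) by (simp add: coord_space_def)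
    qed
  qed
qed

text \<open>Reading a linear relation at the coordinates of block \<open>l\<close> leaves only the copies in that
  block, hence a relation within \<open>B\<close>. The basis is taken inside \<open>F\<^sup>n\<close> because the embedding
  forgets the entries from index \<open>n\<close> on.\<close>

lemma independent_block_copies:
  fixes B :: "(nat \<Rightarrow> 'f::field) set"
  assumes B: "fvec.independent B" "finite B" "B \<subseteq> coord_space n"
  shows "fvec.independent (block_copies n d B)" "card (block_copies n d B) = d * card B"
proof -
  let ?e = "\<lambda>(j, b). block_embed n j b"
  have copies: "block_copies n d B = ?e ` ({..<d} \<times> B)"
    by (auto simp: block_copies_def)
  have "0 \<notin> B"
    using B(1) fvec.dependent_zero by blast
  have inj: "inj_on ?e ({..<d} \<times> B)"
  proof (rule inj_onI, clarify)
    fix j v l w assume vw: "v \<in> B" "w \<in> B" and eq: "block_embed n j v = block_embed n l w"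
    have "v \<in> coord_space n" "w \<in> coord_space n" "v \<noteq> 0"
      using vw B(3) \<open>0 \<notin> B\<close> by blast+
    then show "j = l \<and> v = w"
      using block_embed_inject eq by blast
  qed
  show "card (block_copies n d B) = d * card B"
    unfolding copies by (simp add: card_image[OF inj] card_cartesian_product)
  show "fvec.independent (block_copies n d B)"
  proof (rule fvec.independent_if_scalars_zero)
    show "finite (block_copies n d B)"
      using B(2) by (simp add: copies)
  next
    fix c w
    assume zero: "(\<Sum>v\<in>block_copies n d B. fscale (c v) v) = 0" and w: "w \<in> block_copies n d B"
    then obtain l b where lb: "l < d" "b \<in> B" "w = block_embed n l b"
      by (auto simp: block_copies_def)
    have sum_pairs: "(\<Sum>j<d. \<Sum>b\<in>B. fscale (c (block_embed n j b)) (block_embed n j b)) = 0"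
      using zero unfolding copies sum.reindex[OF inj]
      by (simp add: sum.cartesian_product case_prod_unfold)
    have sum_apply: "(\<Sum>v\<in>S. g v) i = (\<Sum>v\<in>S. g v i)" for S and g :: "'x \<Rightarrow> nat \<Rightarrow> 'f" and i
      by (induction S rule: infinite_finite_induct) auto
    have "(\<Sum>b\<in>B. fscale (c (block_embed n l b)) b) = 0"
    proof
      fix i show "(\<Sum>b\<in>B. fscale (c (block_embed n l b)) b) i = 0 i"
      proof (cases "i < n")
        case True
        have "0 = (\<Sum>j<d. \<Sum>b\<in>B. fscale (c (block_embed n j b)) (block_embed n j b)) (l * n + i)"
          by (simp add: sum_pairs)
        also have "\<dots> = (\<Sum>j<d. \<Sum>b\<in>B. if j = l then c (block_embed n l b) * b i else 0)"
          using True by (simp add: sum_apply fscale_def block_embed_apply if_distrib cong: if_cong)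
        also have "\<dots> = (\<Sum>j<d. if j = l then (\<Sum>b\<in>B. c (block_embed n l b) * b i) else 0)"
          by (intro sum.cong) auto
        also have "\<dots> = (\<Sum>b\<in>B. fscale (c (block_embed n l b)) b) i"
          using lb(1) by (simp add: sum_apply fscale_def)
        finally show ?thesis by simp
      next
        case False
        then show ?thesis
          using B(3) by (auto simp: sum_apply fscale_def coord_space_def intro!: sum.neutral)
      qed
    qed
    then have "c (block_embed n l b) = 0"
      using fvec.independentD[OF B(1,2) subset_refl _ lb(2), of "\<lambda>b. c (block_embed n l b)"] by simp
    then show "c w = 0"
      by (simp add: lb(3))
  qed
qed

lemma dim_block_copies:
  fixes X :: "(nat \<Rightarrow> 'f::{field,finite}) set"
  assumes "X \<subseteq> coord_space n"
  shows "fvec.dim (block_copies n d X) = d * fvec.dim X"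
proof -
  obtain B where B: "B \<subseteq> X" "fvec.independent B" "X \<subseteq> fvec.span B" "card B = fvec.dim X"
    using fvec.basis_exists by metis
  have fB: "finite B" "B \<subseteq> coord_space n"
    using B(1) assms finite_subset[OF _ finite_coord_space] by blast+
  have sub: "block_copies n d B \<subseteq> block_copies n d X"
    using B(1) by (auto simp: block_copies_def)
  have span: "block_copies n d X \<subseteq> fvec.span (block_copies n d B)"
  proof
    fix y assume "y \<in> block_copies n d X"
    then obtain j x where jx: "j < d" "x \<in> X" "y = block_embed n j x"
      by (auto simp: block_copies_def)
    then have "y \<in> fvec.span (block_embed n j ` B)"
      using B(3) block_embed_in_span by blast
    also have "\<dots> \<subseteq> fvec.span (block_copies n d B)"
      using jx(1) by (intro fvec.span_mono) (auto simp: block_copies_def)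
    finally show "y \<in> fvec.span (block_copies n d B)" .
  qed
  show ?thesis
    using fvec.dim_unique[OF sub span] independent_block_copies[OF B(2) fB] B(4) by simp
qed

lemma block_copies_subset_coord_space:
  assumes "n > 0" "d * n \<le> m"
  shows "block_copies n d X \<subseteq> coord_space m"
proof -
  have "i div n \<noteq> j" if "m \<le> i" "j < d" for i j
  proof -
    have "d * n \<le> i" using assms(2) that(1) by linarith
    then have "d \<le> i div n" using assms(1) by (simp add: less_eq_div_iff_mult_less_eq)
    then show ?thesis using that(2) by simp
  qed
  then show ?thesis
    by (auto simp: block_copies_def coord_space_def block_embed_def)
qed

text \<open>Every copy \<open>v\<close> lives in a single block. It is the difference of \<open>v + w\<close> and \<open>w\<close>, where \<open>w\<close>
  has a nonzero entry in two further blocks, so that neither vector lives in a single block. This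
  is why there have to be at least three blocks.\<close>

lemma span_outside_block_copies:
  fixes X :: "(nat \<Rightarrow> 'f::field) set"
  assumes "n > 0" "3 * n \<le> m"
  shows "coord_space m \<subseteq> fvec.span (coord_space m - block_copies n d X)"
proof
  fix v :: "nat \<Rightarrow> 'f" assume v: "v \<in> coord_space m"
  let ?R = "coord_space m - block_copies n d X"
  have outside: "u \<in> ?R"
    if "u \<in> coord_space m" "u (a * n) \<noteq> 0" "u (b * n) \<noteq> 0" "a \<noteq> b" for u a b
  proof -
    have "u \<noteq> block_embed n j x" for j x
      using that(2-4) block_embed_apply[OF assms(1), of j x a] block_embed_apply[OF assms(1), of j x b]
      by (auto split: if_splits)
    then show ?thesis
      using that(1) by (auto simp: block_copies_def)
  qed
  show "v \<in> fvec.span ?R"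
  proof (cases "v \<in> ?R")
    case True
    then show ?thesis by (rule fvec.span_base)
  next
    case False
    then obtain j x where v_eq: "v = block_embed n j x"
      using v by (auto simp: block_copies_def)
    obtain a b where ab: "a < 3" "b < 3" "a \<noteq> b" "a \<noteq> j" "b \<noteq> j"
    proof -
      have "\<exists>a b. a < 3 \<and> b < 3 \<and> a \<noteq> b \<and> a \<noteq> j \<and> b \<noteq> (j::nat)" by presburger
      then show thesis using that by blast
    qed
    define w :: "nat \<Rightarrow> 'f" where "w = (\<lambda>i. if i = a * n \<or> i = b * n then 1 else 0)"
    have "a * n < m" "b * n < m"
      using ab(1,2) assms mult_less_mono1[of _ 3 n] by (metis less_le_trans)+
    then have w: "w \<in> coord_space m"
      by (auto simp: w_def coord_space_def)
    have v0: "v (a * n) = 0" "v (b * n) = 0"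
      using ab block_embed_apply[OF assms(1), of j x a] block_embed_apply[OF assms(1), of j x b]
      by (simp_all add: v_eq)
    have "w \<in> ?R"
      using w ab(3) by (intro outside[of _ a b]) (simp_all add: w_def)
    moreover have "v + w \<in> ?R"
      using v w v0 ab(3) by (intro outside[of _ a b]) (simp_all add: w_def coord_space_def)
    ultimately have "(v + w) - w \<in> fvec.span ?R"
      by (intro fvec.span_diff fvec.span_base)
    then show ?thesis by simp
  qed
qed

section \<open>Approximating quotients in higher dimension\<close>

lemma normalized_rank_eq: "normalized_rank n X = real (fvec.dim X) / real n"
  by (simp add: normalized_rank_def)

text \<open>The copies have rank \<open>d * r\<close> with \<open>d = m div n\<close>, so the only loss is due to the \<open>m mod n\<close>
  coordinates that belong to no block.\<close>

lemma normalized_rank_block_copies: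
  fixes X :: "(nat \<Rightarrow> 'f::{field,finite}) set"
  assumes "n > 0" "n \<le> m" "X \<subseteq> coord_space n"
  shows "\<bar>normalized_rank n X - normalized_rank m (block_copies n (m div n) X)\<bar> \<le> real n / real m"
proof -
  let ?r = "real (fvec.dim X)"
  have mod: "real m = real (m div n) * real n + real (m mod n)"
    by (metis div_mult_mod_eq of_nat_add of_nat_mult)
  have "normalized_rank n X - normalized_rank m (block_copies n (m div n) X)
      = ?r / real n - real (m div n) * ?r / real m"
    using assms(3) by (simp add: normalized_rank_eq dim_block_copies)
  also have "\<dots> = (?r / real n) * (real (m mod n) / real m)"
    using assms(1,2) mod by (simp add: field_simps)
  finally have eq: "normalized_rank n X - normalized_rank m (block_copies n (m div n) X)
      = normalized_rank n X * (real (m mod n) / real m)"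
    by (simp add: normalized_rank_eq)
  have "normalized_rank n X * (real (m mod n) / real m) \<le> 1 * (real n / real m)"
    using normalized_rank_range[OF assms(3)] assms(1,2)
    by (intro mult_mono divide_right_mono) (auto simp: less_imp_le)
  moreover have "0 \<le> normalized_rank n X * (real (m mod n) / real m)"
    using normalized_rank_range[OF assms(3)] by simp
  ultimately show ?thesis
    by (simp add: eq)
qed

lemma normalized_rank_Diff_zero: "normalized_rank n (X - {0}) = normalized_rank n X"
  by (simp add: normalized_rank_def)

text \<open>The new partition keeps copies of all classes except an almost spanning one, \<open>s\<close>, to which
  everything else is given. The two terms of the bound correspond to the index sets \<open>I\<close> that contain
  \<open>s\<close> and to those that do not.\<close>

lemma quotient_approximation:
  fixes A :: "nat \<Rightarrow> (nat \<Rightarrow> 'f::{field,finite}) set"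
  assumes A: "labelled_partition k (coord_space n) A" and n: "n > 0" and m: "3 * n \<le> m"
  obtains A' :: "nat \<Rightarrow> (nat \<Rightarrow> 'f) set" where "labelled_partition k (coord_space m) A'"
    and "linf_dist k (quotient_fun k (normalized_rank n) A) (quotient_fun k (normalized_rank m) A')
          \<le> max (real k / real n) (real n / real m)"
proof -
  obtain s where s: "s \<in> {1..k}" "n \<le> fvec.dim (A s) + k"
    using labelled_partition_large_class[OF A] .
  \<comment> \<open>The zero vector has the same image in every block, and only nonzero vectors can be traced
    back to their block and class; dropping it does not change any span.\<close>
  define C where "C i = block_copies n (m div n) (A i - {0})" for i
  define R where "R = coord_space m - block_copies n (m div n) (\<Union>i\<in>{1..k} - {s}. A i - {0})"
  define A' where "A' i = (if i = s then R else C i)" for i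
  have cover: "(\<Union>i\<in>{1..k}. A i) = coord_space n" and disj: "disjoint_family_on A {1..k}"
    using A by (simp_all add: labelled_partition_def)
  have C_Union: "(\<Union>i\<in>I. C i) = block_copies n (m div n) (\<Union>i\<in>I. A i - {0})" for I
    by (auto simp: C_def block_copies_def)
  have C_sub: "C i \<subseteq> coord_space m" for i
    unfolding C_def by (rule block_copies_subset_coord_space) (use n in simp_all)
  have C_disj: "C i \<inter> C l = {}" if "i \<in> {1..k}" "l \<in> {1..k}" "i \<noteq> l" for i l
  proof -
    have False if "v \<in> A i - {0}" "w \<in> A l - {0}" "block_embed n j v = block_embed n j' w" for v w j j'
    proof -
      have "v \<in> coord_space n" "w \<in> coord_space n" "v \<noteq> 0"
        using that cover \<open>i \<in> {1..k}\<close> \<open>l \<in> {1..k}\<close> by blast+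
      then have "v = w"
        using block_embed_inject(2) that(3) by blast
      then show False
        using that disj \<open>i \<in> {1..k}\<close> \<open>l \<in> {1..k}\<close> \<open>i \<noteq> l\<close> unfolding disjoint_family_on_def by blast
    qed
    then show ?thesis
      by (fastforce simp: C_def block_copies_def)
  qed
  have R_eq: "R = coord_space m - (\<Union>i\<in>{1..k} - {s}. C i)"
    by (simp add: R_def C_Union)
  have "labelled_partition k (coord_space m) A'"
    unfolding labelled_partition_def
  proof
    show "disjoint_family_on A' {1..k}"
      using C_disj by (auto simp: disjoint_family_on_def A'_def R_eq)
    have "(\<Union>i\<in>{1..k}. A' i) = R \<union> (\<Union>i\<in>{1..k} - {s}. C i)"
      using s(1) by (auto simp: A'_def split: if_splits)
    then show "(\<Union>i\<in>{1..k}. A' i) = coord_space m"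
      using C_sub by (auto simp: R_eq)
  qed
  moreover have "\<bar>normalized_rank n (\<Union>i\<in>I. A i) - normalized_rank m (\<Union>i\<in>I. A' i)\<bar>
      \<le> max (real k / real n) (real n / real m)" if I: "I \<subseteq> {1..k}" for I
  proof (cases "s \<in> I")
    case True
    have sub: "(\<Union>i\<in>I. A i) \<subseteq> coord_space n" "(\<Union>i\<in>I. A' i) \<subseteq> coord_space m"
      using I cover C_sub by (fastforce simp: A'_def R_def split: if_splits)+
    have "n \<le> fvec.dim (\<Union>i\<in>I. A i) + k"
      using s(2) True dim_mono_finite[of "A s" "\<Union>i\<in>I. A i"]
        finite_subset[OF sub(1) finite_coord_space] by fastforce
    then have "(real n - real k) / real n \<le> normalized_rank n (\<Union>i\<in>I. A i)"
      unfolding normalized_rank_eq by (intro divide_right_mono) linarith+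
    then have "1 - real k / real n \<le> normalized_rank n (\<Union>i\<in>I. A i)"
      using n by (simp add: diff_divide_distrib)
    moreover have "normalized_rank n (\<Union>i\<in>I. A i) \<le> 1"
      using normalized_rank_range[OF sub(1)] by simp
    moreover have "normalized_rank m (\<Union>i\<in>I. A' i) = 1"
    proof -
      have "coord_space m \<subseteq> fvec.span R"
        unfolding R_def using n m by (rule span_outside_block_copies)
      also have "\<dots> \<subseteq> fvec.span (\<Union>i\<in>I. A' i)"
        using True by (intro fvec.span_mono) (auto simp: A'_def)
      finally have "fvec.span (\<Union>i\<in>I. A' i) = coord_space m"
        using sub(2) fvec.span_minimal subspace_coord_space by blast
      then show ?thesis
        using n m by (simp add: normalized_rank_def dim_coord_space)
    qed
    ultimately show ?thesis by (simp add: le_max_iff_disj)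
  next
    case False
    have "(\<Union>i\<in>I. A' i) = (\<Union>i\<in>I. C i)"
      using False by (auto simp: A'_def)
    also have "\<dots> = block_copies n (m div n) ((\<Union>i\<in>I. A i) - {0})"
      unfolding C_Union by (rule arg_cong[where f = "block_copies n (m div n)"]) blast
    finally have copies: "(\<Union>i\<in>I. A' i) = block_copies n (m div n) ((\<Union>i\<in>I. A i) - {0})" .
    have "(\<Union>i\<in>I. A i) - {0} \<subseteq> coord_space n"
      using I cover by blast
    then have "\<bar>normalized_rank n ((\<Union>i\<in>I. A i) - {0}) - normalized_rank m (\<Union>i\<in>I. A' i)\<bar>
        \<le> real n / real m"
      unfolding copies using n m by (intro normalized_rank_block_copies) auto
    then show ?thesis
      by (simp add: normalized_rank_Diff_zero le_max_iff_disj)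
  qed
  ultimately show thesis
    by (intro that[of A']) (simp_all add: linf_dist_le_iff quotient_fun_def)
qed

theorem theorem4p1:
  fixes q :: nat
  assumes "card (UNIV :: 'f::{field,finite} set) = q"
  shows "quotient_convergent
           (\<lambda>n. coord_space (Suc n) :: (nat \<Rightarrow> 'f) set)
           (\<lambda>n. normalized_rank (Suc n))"
proof (rule quotient_convergentI)
  fix n show "setfunction (coord_space (Suc n) :: (nat \<Rightarrow> 'f) set) (normalized_rank (Suc n))"
    using fvec.dim_le_card[of "{} :: (nat \<Rightarrow> 'f) set" "{}"]
    by (simp add: setfunction_def finite_coord_space normalized_rank_eq)
next
  fix n and X :: "(nat \<Rightarrow> 'f) set" assume "X \<subseteq> coord_space (Suc n)"
  then show "normalized_rank (Suc n) X \<in> {0..1}"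
    by (rule normalized_rank_range)
next
  fix k :: nat and \<epsilon> :: real assume "k \<ge> 1" "\<epsilon> > 0"
  define Q where "Q n = quotient_set k (coord_space (Suc n) :: (nat \<Rightarrow> 'f) set)
    (normalized_rank (Suc n))" for n
  obtain N :: nat where N: "real k / \<epsilon> \<le> real N"
    using real_arch_simple by blast
  have "\<exists>M. \<forall>m\<ge>M. \<forall>f\<in>Q n. \<exists>g\<in>Q m. linf_dist k f g \<le> \<epsilon>" if "n \<ge> N" for n
  proof -
    obtain M :: nat where M: "real (Suc n) / \<epsilon> \<le> real M"
      using real_arch_simple by blast
    have "\<exists>g\<in>Q m. linf_dist k f g \<le> \<epsilon>" if m: "m \<ge> max M (3 * Suc n)" and "f \<in> Q n" for m f
    proof -
      obtain A where A: "labelled_partition k (coord_space (Suc n) :: (nat \<Rightarrow> 'f) set) A"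
        and f: "f = quotient_fun k (normalized_rank (Suc n)) A"
        using \<open>f \<in> Q n\<close> unfolding Q_def quotient_set_def by blast
      have "3 * Suc n \<le> Suc m"
        using m by simp
      then obtain A' where A': "labelled_partition k (coord_space (Suc m) :: (nat \<Rightarrow> 'f) set) A'"
        and dist: "linf_dist k f (quotient_fun k (normalized_rank (Suc m)) A')
          \<le> max (real k / real (Suc n)) (real (Suc n) / real (Suc m))"
        using quotient_approximation[OF A] f by blast
      have "real k / \<epsilon> \<le> real (Suc n)" "real (Suc n) / \<epsilon> \<le> real (Suc m)"
        using N M \<open>n \<ge> N\<close> m by linarith+
      then have "max (real k / real (Suc n)) (real (Suc n) / real (Suc m)) \<le> \<epsilon>"
        using \<open>\<epsilon> > 0\<close> by (simp add: divide_le_eq mult.commute del: of_nat_Suc)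
      then show ?thesis
        using A' dist unfolding Q_def quotient_set_def by force
    qed
    then show ?thesis by blast
  qed
  then show "\<exists>N. \<forall>n\<ge>N. \<exists>M. \<forall>m\<ge>M.
      \<forall>f\<in>quotient_set k (coord_space (Suc n) :: (nat \<Rightarrow> 'f) set) (normalized_rank (Suc n)).
      \<exists>g\<in>quotient_set k (coord_space (Suc m) :: (nat \<Rightarrow> 'f) set) (normalized_rank (Suc m)).
        linf_dist k f g \<le> \<epsilon>"
    unfolding Q_def by blast
qed

end
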